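(* Let $N\in\mathbb{N}=\{1,2,3,\ldots\}$, let $\phi:(0,+\infty)\to(0,1]$ be a non-increasing function, and let $\boldsymbol{\alpha}\in\mathbb{R}^{N}$ be a $\phi$-badly approximable vector. For $Q\geq 1$ put $X:=[-Q,Q]^N$. Then there are constants depending only on $N$ such that for all $Q\geq 1$, $$Q^{N}\log\left(Q\phi(Q)\right)\ll_{N}\sum_{\boldsymbol{q}\in X \cap\mathbb{Z}^{N}\setminus\{\boldsymbol{0}\}}\left\|\boldsymbol{\alpha}\cdot\boldsymbol{q}\right\|^{-1}\ll_{N}Q^{N}\log Q+\frac{Q^{N}}{\phi(Q)}.$$
   Context: $\|x\|$ denotes the distance from a real number $x$ to the nearest integer; $\boldsymbol{x}\cdot\boldsymbol{y}=\sum_{i=1}^N x_iy_i$ is the standard inner product; $|\cdot|_\infty$ is the maximum norm on $\mathbb{R}^N$. "Non-increasing" means $\phi(x)\geq\phi(y)$ whenever $x<y$. A vector $\boldsymbol{\alpha}\in\mathbb{R}^N$ is called $\phi$-badly approximable if $|\boldsymbol{q}|_{\infty}^{N}\|\boldsymbol{\alpha}\cdot\boldsymbol{q}\|\geq\phi(|\boldsymbol{q}|_{\infty})$ for all $\boldsymbol{q}\in\mathbb{Z}^N\setminus\{\boldsymbol{0}\}$. $A\ll_N B$ means $A\leq cB$ for some constant $c>0$ depending only on $N$. *)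

theory Defs
  imports "HOL-Analysis.Analysis"
begin

definition dist_nint :: "real \<Rightarrow> real" where
  "dist_nint x = \<bar>x - of_int (round x)\<bar>"

definition int_lattice :: "(real ^ 'n) set" where
  "int_lattice = {q. \<forall>i. q $ i \<in> \<int>}"

(* infnorm is the maximum norm of the coordinates; the dimension is CARD('n). *)
definition badly_approximable :: "(real \<Rightarrow> real) \<Rightarrow> real ^ 'n \<Rightarrow> bool" where
  "badly_approximable \<phi> \<alpha> \<longleftrightarrow>
     (\<forall>q \<in> int_lattice - {0}. infnorm q ^ CARD('n) * dist_nint (\<alpha> \<bullet> q) \<ge> \<phi> (infnorm q))"

definition centered_cube :: "real \<Rightarrow> (real ^ 'n) set" where
  "centered_cube Q = cbox (\<chi> i. - Q) (\<chi> i. Q)"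

end

theory Submission
  imports Defs
begin

text \<open>
  Put \<open>\<delta> = \<phi> Q / Q^N\<close>. All distances occurring in the sum are at least \<open>\<delta>\<close>, so everything follows
  from a dyadic summation and bounds for the number of \<open>q\<close> with distance at most \<open>t\<close>.

  For the upper bound, these \<open>q\<close> correspond to points of the lattice of all
  \<open>(q, \<alpha> \<bullet> q + p)\<close> in the box \<open>[-Q, Q]^N \<times> [-t, t]\<close>. If they span the whole space, their number is
  \<open>O(t Q^N)\<close> by a volume argument. Otherwise they lie in a hyperplane, and since bad
  approximability separates them, it is \<open>O((t / \<delta>)^{N / (N + 1)})\<close>. The first term contributes
  \<open>Q^N\<close> for each of the \<open>O(log (1 / \<delta>))\<close> scales, the second one a geometric series dominated by the
  scale \<open>t = \<delta>\<close>.

  For the lower bound, Dirichlet's pigeonhole argument gives at least \<open>t Q^N - 1\<close> such \<open>q\<close>, which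
  yields even \<open>Q^N log Q\<close>; bad approximability serves only to exclude vanishing distances.
\<close>

subsection \<open>Integer points in a linear image of the cube\<close>

lemma abs_det_le_fact:
  fixes A :: "real^'m^'m"
  assumes "\<And>i j. \<bar>A $ i $ j\<bar> \<le> 1"
  shows "\<bar>det A\<bar> \<le> fact CARD('m)"
proof -
  have "\<bar>det A\<bar> \<le> (\<Sum>p | p permutes (UNIV :: 'm set). \<bar>of_int (sign p) * (\<Prod>i\<in>UNIV. A $ i $ p i)\<bar>)"
    unfolding det_def by (rule sum_abs)
  also have "\<dots> \<le> (\<Sum>p | p permutes (UNIV :: 'm set). 1)"
    by (intro sum_mono) (auto simp: abs_mult abs_prod sign_def assms intro: prod_le_1)
  also have "\<dots> = fact CARD('m)"
    using card_permutations[of "UNIV :: 'm set" "CARD('m)"] by simp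
  finally show ?thesis .
qed

text \<open>Distinct integer points differ by at least 1 in some coordinate, so the open unit boxes
  at them are disjoint; \<open>1\<close> is the all-ones vector here. Volume thus bounds
  cardinality.\<close>

lemma card_int_lattice_le_measure:
  fixes Y :: "(real^'m) set"
  assumes "finite Y" "Y \<subseteq> int_lattice" and S: "S \<in> lmeasurable"
    and sub: "\<And>y. y \<in> Y \<Longrightarrow> box y (y + 1) \<subseteq> S"
  shows "real (card Y) \<le> measure lebesgue S"
proof -
  let ?B = "\<lambda>y :: real^'m. box y (y + 1)"
  have meas1: "measure lebesgue (?B y) = 1" for y
  proof -
    have "cbox y (y + 1) \<noteq> {}" by (auto simp: interval_ne_empty_cart)
    then show ?thesis
      by (auto simp: measure_lborel_box_eq box_ne_empty Basis_vec_def inner_axis intro!: prod.neutral)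
  qed
  have disj: "disjoint_family_on ?B Y"
  proof (unfold disjoint_family_on_def, intro ballI impI)
    fix x y assume xy: "x \<in> Y" "y \<in> Y" "x \<noteq> y"
    then obtain i where i: "x $ i \<noteq> y $ i" by (auto simp: vec_eq_iff)
    obtain a b where ab: "x $ i = of_int a" "y $ i = of_int b"
      using xy assms(2) by (force simp: int_lattice_def Ints_def)
    have False if "z \<in> ?B x" "z \<in> ?B y" for z
    proof -
      have "of_int a < z $ i" "z $ i < of_int a + 1" "of_int b < z $ i" "z $ i < of_int b + 1"
        using that ab by (auto simp: mem_box_cart dest: spec[of _ i])
      then have "a < b + 1" "b < a + 1" by linarith+
      then show False using i ab by auto
    qed
    then show "?B x \<inter> ?B y = {}" by blast
  qed
  have "real (card Y) = (\<Sum>y\<in>Y. measure lebesgue (?B y))"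
    by (simp add: meas1)
  also have "\<dots> = measure lebesgue (\<Union>y\<in>Y. ?B y)"
    by (rule measure_finite_Union[symmetric]) (use assms disj in \<open>auto simp: emeasure_lborel_box_eq\<close>)
  also have "\<dots> \<le> measure lebesgue S"
    by (rule measure_mono_fmeasurable) (use sub S assms(1) in \<open>auto intro!: sets.finite_UN\<close>)
  finally show ?thesis .
qed

lemma card_funs_atLeastLessThan:
  "card (PiE (UNIV :: 'm::finite set) (\<lambda>_. {0..<T})) = T ^ CARD('m)"
  by (simp add: card_PiE)

text \<open>A tuple of vectors of \<open>F\<close> with maximal determinant gives, by Cramer's rule, coordinates in
  \<open>[-1, 1]\<close> on \<open>F\<close>; hence the translates of \<open>F\<close> by \<open>3 A m\<close> are disjoint, and the unit boxes at
  their points are packed in a parallelepiped.\<close>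

lemma card_le_max_det:
  fixes F :: "(real^'m::{finite,wellorder}) set"
  assumes fin: "finite F" and F: "F \<subseteq> int_lattice"
    and A: "\<And>j. column j A \<in> F" and D: "det A \<noteq> 0"
    and max: "\<And>B. (\<And>j. column j B \<in> F) \<Longrightarrow> \<bar>det B\<bar> \<le> \<bar>det A\<bar>"
  shows "real (card F) \<le> 4 ^ CARD('m) * \<bar>det A\<bar>"
proof -
  obtain A' where A': "A' ** A = mat 1" "A ** A' = mat 1"
    using D invertible_det_nz[of A] by (auto simp: invertible_def)
  have inv1: "A *v (A' *v x) = x" "A' *v (A *v x) = x" for x
    by (simp_all add: matrix_vector_mul_assoc A')
  \<comment> \<open>Replacing column \<open>k\<close> of \<open>A\<close> by \<open>x\<close>
    multiplies the determinant by coordinate \<open>k\<close> of \<open>A' *v x\<close>; maximality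
    bounds this factor by 1.\<close>
  have coord: "\<bar>(A' *v x) $ k\<bar> \<le> 1" if "x \<in> F" for x k
  proof -
    let ?B = "\<chi> i j. if j = k then (A *v (A' *v x)) $ i else A $ i $ j"
    have "column j ?B = (if j = k then x else column j A)" for j
      by (auto simp: column_def vec_eq_iff inv1)
    then have "\<bar>det ?B\<bar> \<le> \<bar>det A\<bar>" using that A by (intro max) auto
    then show ?thesis using D by (simp add: cramer_lemma abs_mult)
  qed
  have "bounded ((\<lambda>x. A' *v x) ` box 0 1)"
    by (intro bounded_linear_image bounded_box) (simp add: linear_linear[symmetric])
  then obtain C0 where C0: "\<And>u. u \<in> box 0 1 \<Longrightarrow> norm (A' *v u) \<le> C0"
    by (auto simp: bounded_iff)
  \<comment> \<open>In the coordinates given by \<open>A'\<close>, the unit boxes stick out by at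
    most \<open>C\<close>. A large \<open>T\<close> absorbs this overhang:
    \<open>3 * T + 1 + 2 * C \<le> 4 * T\<close>, the source of the base 4.\<close>
  obtain T :: nat where T: "real T \<ge> 1 + 2 * max C0 0" using real_arch_simple by blast
  define C where "C = max C0 0"
  have T1: "1 + 2 * C \<le> real T" "C \<ge> 0" "real T > 0" using T by (auto simp: C_def)
  have C: "\<bar>(A' *v u) $ k\<bar> \<le> C" if "u \<in> box 0 1" for u k
    using C0[OF that] component_le_norm_cart[of "A' *v u" k] by (auto simp: C_def)
  define M where "M = (UNIV \<rightarrow>\<^sub>E {0..<T} :: ('m \<Rightarrow> nat) set)"
  \<comment> \<open>The coordinates of \<open>F\<close> lie in an interval of length 2, so a spacing
    of 3 keeps the translates apart.\<close>
  define v where "v = (\<lambda>m :: 'm \<Rightarrow> nat. (\<chi> i. 3 * real (m i)) :: real^'m::_)"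
  define h where "h = (\<lambda>(x, m). x + A *v v m)"
  define Y where "Y = h ` (F \<times> M)"
  have A'h: "A' *v h (x, m) = A' *v x + v m" for x m
    by (simp add: h_def matrix_vector_right_distrib inv1)
  have inj: "inj_on h (F \<times> M)"
  proof (rule inj_onI, clarify)
    fix x m x' m' assume *: "x \<in> F" "m \<in> M" "x' \<in> F" "m' \<in> M" "h (x, m) = h (x', m')"
    have "m i = m' i" for i
    proof -
      have "(A' *v x) $ i + 3 * real (m i) = (A' *v x') $ i + 3 * real (m' i)"
        using arg_cong[OF *(5), of "\<lambda>z. (A' *v z) $ i"] by (simp add: A'h v_def)
      moreover have "\<bar>(A' *v x) $ i\<bar> \<le> 1" "\<bar>(A' *v x') $ i\<bar> \<le> 1" using * coord by auto
      ultimately show ?thesis by linarith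
    qed
    then have "m = m'" by auto
    then show "x = x' \<and> m = m'" using * by (simp add: h_def)
  qed
  have finM: "finite M" by (simp add: M_def finite_PiE)
  have "card Y = card F * T ^ CARD('m)"
    using card_image[OF inj] by (simp add: Y_def card_cartesian_product M_def card_funs_atLeastLessThan)
  have Aint: "A $ i $ j \<in> \<int>" for i j
    using A[of j] F by (auto simp: int_lattice_def column_def)
  have Fint: "x $ i \<in> \<int>" if "x \<in> F" for x i
    using that F by (auto simp: int_lattice_def)
  have Yint: "Y \<subseteq> int_lattice"
    by (auto simp: Y_def h_def int_lattice_def matrix_vector_mult_def v_def Aint Fint
        intro!: Ints_add Ints_sum Ints_mult)
  let ?lo = "(\<chi> i. - 1 - C) :: real^'m::_" and ?hi = "(\<chi> i. 3 * real T + C) :: real^'m::_"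
  let ?S = "(\<lambda>x. A *v x) ` cbox ?lo ?hi"
  have lin: "linear (\<lambda>x. A *v x)" by simp
  have sub: "box y (y + 1) \<subseteq> ?S" if "y \<in> Y" for y
  proof
    fix z assume z: "z \<in> box y (y + 1)"
    from that obtain x m where xm: "x \<in> F" "m \<in> M" "y = h (x, m)" by (auto simp: Y_def)
    have u: "z - y \<in> box 0 1" using z by (auto simp: mem_box_cart algebra_simps)
    have "A' *v z = A' *v y + A' *v (z - y)" by (simp add: matrix_vector_right_distrib[symmetric])
    also have "\<dots> = A' *v x + v m + A' *v (z - y)" by (simp add: xm A'h)
    finally have e: "A' *v z = A' *v x + v m + A' *v (z - y)" .
    have "A' *v z \<in> cbox ?lo ?hi"
    proof (unfold mem_box_cart, intro allI)
      fix i
      have "real (m i) + 1 \<le> real T"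
        using xm(2) by (auto simp: M_def PiE_def Pi_def Suc_le_eq dest!: spec[of _ i])
      moreover have "\<bar>(A' *v x) $ i\<bar> \<le> 1" "\<bar>(A' *v (z - y)) $ i\<bar> \<le> C" using xm coord C[OF u] by auto
      ultimately show "?lo $ i \<le> (A' *v z) $ i \<and> (A' *v z) $ i \<le> ?hi $ i"
        unfolding e by (simp add: v_def) linarith
    qed
    then show "z \<in> ?S" using inv1(1)[of z] by (metis image_eqI)
  qed
  have ne: "cbox ?lo ?hi \<noteq> {}"
    using T1 by (auto simp: interval_ne_empty_cart)
  have "real (card F) * real T ^ CARD('m) = real (card Y)" using \<open>card Y = _\<close> by simp
  also have "\<dots> \<le> measure lebesgue ?S"
    by (rule card_int_lattice_le_measure[OF _ Yint _ sub])
      (use fin finM lin in \<open>auto simp: Y_def intro: measurable_linear_image\<close>)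
  also have "\<dots> = \<bar>det A\<bar> * (3 * real T + 1 + 2 * C) ^ CARD('m)"
    using measure_linear_image[OF lin, of "cbox ?lo ?hi"] ne
    by (simp add: content_cbox_cart algebra_simps)
  also have "\<dots> \<le> \<bar>det A\<bar> * (4 * real T) ^ CARD('m)"
    using T1 by (intro mult_left_mono power_mono) auto
  finally show ?thesis using T1 by (simp add: power_mult_distrib mult.commute)
qed

text \<open>Ensures that the maximal determinant in \<open>card_le_of_span_UNIV\<close> is non-zero.
  The columns are a basis of the space extracted from \<open>F\<close>.\<close>

lemma exists_column_matrix_det_nonzero:
  fixes F :: "(real^'m) set"
  assumes "span F = UNIV"
  obtains A where "\<And>j. column j A \<in> F" "det A \<noteq> 0"
proof -
  obtain B where B: "B \<subseteq> F" "independent B" "F \<subseteq> span B"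
    using maximal_independent_subset by blast
  have spB: "span B = UNIV" using B assms span_mono[of F "span B"] by (simp add: span_span top.extremum_unique)
  then have "card B = CARD('m)"
    using dim_span_eq_card_independent[OF B(2)] by (simp add: dim_UNIV)
  moreover have "finite B" using B(2) by (simp add: independent_imp_finite)
  ultimately obtain f where f: "bij_betw f (UNIV :: 'm set) B"
    by (metis finite_same_card_bij finite)
  define A where "A = (\<chi> i j. f j $ i)"
  have col: "column j A = f j" for j by (simp add: A_def column_def vec_eq_iff)
  have "columns A = B" using f by (auto simp: columns_def col bij_betw_def)
  then have "\<exists>A'. A ** A' = mat 1"
    using matrix_right_invertible_span_columns[of A] spB by (simp add: span_vec_eq)
  then have "det A \<noteq> 0" by (metis det_I det_mul mult_zero_left zero_neq_one)
  moreover have "column j A \<in> F" for j using f B by (auto simp: col bij_betw_def)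
  ultimately show ?thesis using that by blast
qed

text \<open>For the tuple \<open>A\<close> of maximal determinant, \<open>L ** A\<close> has entries
  bounded by 1, so \<open>\<bar>det L\<bar> * \<bar>det A\<bar>\<close> is bounded in terms of the
  dimension; \<open>card_le_max_det\<close> then bounds the cardinality.\<close>

lemma card_le_of_span_UNIV:
  fixes F :: "(real^'m::{finite,wellorder}) set" and L :: "real^'m::_^'m::_"
  assumes fin: "finite F" and F: "F \<subseteq> int_lattice" and sp: "span F = UNIV"
    and L: "det L \<noteq> 0" "\<And>x k. x \<in> F \<Longrightarrow> \<bar>(L *v x) $ k\<bar> \<le> 1"
  shows "real (card F) \<le> 4 ^ CARD('m) * fact CARD('m) / \<bar>det L\<bar>"
proof -
  let ?S = "{A :: real^'m::_^'m::_. \<forall>j. column j A \<in> F}"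
  have "?S \<subseteq> (\<lambda>f. \<chi> i j. f j $ i) ` (UNIV \<rightarrow>\<^sub>E F)"
  proof
    fix A assume "A \<in> ?S"
    then show "A \<in> (\<lambda>f. \<chi> i j. f j $ i) ` (UNIV \<rightarrow>\<^sub>E F)"
      by (intro image_eqI[of _ _ "\<lambda>j. column j A"]) (auto simp: column_def vec_eq_iff)
  qed
  then have finS: "finite ?S"
    by (rule finite_subset) (simp add: finite_PiE fin)
  obtain A0 where A0: "A0 \<in> ?S" "det A0 \<noteq> 0"
    using exists_column_matrix_det_nonzero[OF sp] by blast
  have "Max ((\<lambda>A. \<bar>det A\<bar>) ` ?S) \<in> (\<lambda>A. \<bar>det A\<bar>) ` ?S"
    using finS A0 by (intro Max_in) auto
  then obtain A where A: "A \<in> ?S" "\<bar>det A\<bar> = Max ((\<lambda>A. \<bar>det A\<bar>) ` ?S)" by auto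
  have max: "\<bar>det B\<bar> \<le> \<bar>det A\<bar>" if "B \<in> ?S" for B
    using that finS unfolding A(2) by (intro Max_ge) auto
  have "\<bar>(L ** A) $ i $ j\<bar> \<le> 1" for i j
  proof -
    have "(L ** A) $ i $ j = (L *v column j A) $ i"
      by (simp add: matrix_matrix_mult_def column_def matrix_vector_mult_def)
    then show ?thesis using L(2) A(1) by simp
  qed
  then have "\<bar>det L\<bar> * \<bar>det A\<bar> \<le> fact CARD('m)"
    using abs_det_le_fact[of "L ** A"] by (simp add: det_mul abs_mult)
  then have "4 ^ CARD('m) * \<bar>det A\<bar> \<le> 4 ^ CARD('m) * fact CARD('m) / \<bar>det L\<bar>"
    using L(1) by (simp add: field_simps)
  moreover have "real (card F) \<le> 4 ^ CARD('m) * \<bar>det A\<bar>"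
    using A A0 max by (intro card_le_max_det fin F) (force, use max[of A0] in auto)
  ultimately show ?thesis by linarith
qed

text \<open>In a hyperplane one coordinate is determined by the others, which lowers the exponent of
  the pigeonhole count by 1. The coordinate to drop is the one where the normal vector
  \<open>a\<close> is largest.\<close>

lemma hyperplane_pigeonhole:
  fixes G :: "(real^'m) set" and M :: nat
  assumes "finite G" "M > 0" "a \<noteq> 0"
    and orth: "\<And>z. z \<in> G \<Longrightarrow> a \<bullet> z = 0"
    and bd: "\<And>z k. z \<in> G \<Longrightarrow> \<bar>z $ k\<bar> \<le> 1"
    and card: "card G > (M + 1) ^ (CARD('m) - 1)"
  obtains z z' where "z \<in> G" "z' \<in> G" "z \<noteq> z'" "\<And>k. \<bar>z $ k - z' $ k\<bar> \<le> 2 * real CARD('m) / real M"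
proof -
  have "Max (range (\<lambda>i. \<bar>a $ i\<bar>)) \<in> range (\<lambda>i. \<bar>a $ i\<bar>)"
    by (intro Max_in) auto
  then obtain i0 where i0: "\<bar>a $ i0\<bar> = Max (range (\<lambda>i. \<bar>a $ i\<bar>))" by (metis imageE)
  have ai: "\<bar>a $ i\<bar> \<le> \<bar>a $ i0\<bar>" for i
    unfolding i0 by (intro Max_ge) auto
  have ai0: "\<bar>a $ i0\<bar> > 0"
  proof (rule ccontr)
    assume "\<not> ?thesis"
    then have "a $ i = 0" for i using ai[of i] by simp
    then show False using \<open>a \<noteq> 0\<close> by (auto simp: vec_eq_iff)
  qed
  \<comment> \<open>The range [-1, 1] is cut into intervals of length \<open>2 / M\<close>; the
    index \<open>M\<close> arises only at the endpoint 1, whence \<open>M + 1\<close> cells per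
    coordinate.\<close>
  define g where "g = (\<lambda>z :: real^'m. \<lambda>i\<in>UNIV - {i0}. nat \<lfloor>(z $ i + 1) * real M / 2\<rfloor>)"
  have "nat \<lfloor>(z $ i + 1) * real M / 2\<rfloor> \<le> M" if "z \<in> G" for z i
  proof -
    have "(z $ i + 1) * real M \<le> 2 * real M"
      using bd[OF that, of i] by (intro mult_right_mono) auto
    then show ?thesis by (simp add: nat_le_iff floor_le_iff)
  qed
  then have "g ` G \<subseteq> (UNIV - {i0}) \<rightarrow>\<^sub>E {0..M}"
    by (auto simp: g_def split: if_splits)
  then have "card (g ` G) \<le> card ((UNIV - {i0}) \<rightarrow>\<^sub>E {0..M})"
    by (intro card_mono finite_PiE) auto
  also have "\<dots> = (M + 1) ^ (CARD('m) - 1)" by (simp add: card_PiE)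
  finally have "\<not> inj_on g G" using card by (intro pigeonhole) auto
  then obtain z z' where z: "z \<in> G" "z' \<in> G" "z \<noteq> z'" "g z = g z'" by (auto simp: inj_on_def)
  have near: "\<bar>z $ i - z' $ i\<bar> \<le> 2 / real M" if "i \<noteq> i0" for i
  proof -
    have "nat \<lfloor>(z $ i + 1) * real M / 2\<rfloor> = nat \<lfloor>(z' $ i + 1) * real M / 2\<rfloor>"
      using fun_cong[OF z(4), of i] that by (simp add: g_def)
    moreover have "(z $ i + 1) * real M / 2 \<ge> 0" "(z' $ i + 1) * real M / 2 \<ge> 0"
      using bd[OF z(1), of i] bd[OF z(2), of i] by auto
    ultimately have "\<lfloor>(z $ i + 1) * real M / 2\<rfloor> = \<lfloor>(z' $ i + 1) * real M / 2\<rfloor>"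
      by (simp add: nat_eq_iff)
    then have *: "\<bar>(z $ i + 1) * real M / 2 - (z' $ i + 1) * real M / 2\<bar> \<le> 1"
      by linarith
    have "(z $ i + 1) * real M / 2 - (z' $ i + 1) * real M / 2 = (z $ i - z' $ i) * (real M / 2)"
      by (simp add: field_simps)
    then have "\<bar>z $ i - z' $ i\<bar> * (real M / 2) \<le> 1" using * by (simp add: abs_mult)
    then show ?thesis using \<open>M > 0\<close> by (simp add: field_simps)
  qed
  \<comment> \<open>Orthogonality expresses the difference in coordinate \<open>i0\<close> through
    the others. As no entry of \<open>a\<close> is larger than that at \<open>i0\<close>, at most a
    factor \<open>CARD('m)\<close> is lost.\<close>
  have "a \<bullet> (z - z') = 0" using orth z by (simp add: inner_diff_right)
  then have "(\<Sum>i\<in>UNIV. a $ i * (z $ i - z' $ i)) = 0" by (simp add: inner_vec_def)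
  then have "\<bar>a $ i0 * (z $ i0 - z' $ i0)\<bar> = \<bar>\<Sum>i\<in>UNIV - {i0}. a $ i * (z $ i - z' $ i)\<bar>"
    using sum.remove[of UNIV i0 "\<lambda>i. a $ i * (z $ i - z' $ i)"] by simp
  then have "\<bar>a $ i0\<bar> * \<bar>z $ i0 - z' $ i0\<bar> = \<bar>\<Sum>i\<in>UNIV - {i0}. a $ i * (z $ i - z' $ i)\<bar>"
    by (simp only: abs_mult)
  also have "\<dots> \<le> (\<Sum>i\<in>UNIV - {i0}. \<bar>a $ i * (z $ i - z' $ i)\<bar>)"
    by (rule sum_abs)
  also have "\<dots> \<le> (\<Sum>i\<in>UNIV - {i0}. \<bar>a $ i0\<bar> * (2 / real M))"
    unfolding abs_mult by (intro sum_mono mult_mono ai near) auto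
  also have "\<dots> \<le> (\<Sum>i\<in>(UNIV :: 'm set). \<bar>a $ i0\<bar> * (2 / real M))"
    by (intro sum_mono2) auto
  also have "\<dots> = \<bar>a $ i0\<bar> * (2 * real CARD('m) / real M)" by simp
  finally have far: "\<bar>z $ i0 - z' $ i0\<bar> \<le> 2 * real CARD('m) / real M"
    using ai0 by (simp only: mult_le_cancel_left_pos)
  have "2 * 1 / real M \<le> 2 * real CARD('m) / real M"
    by (intro divide_right_mono mult_left_mono) (auto simp: Suc_le_eq)
  then have "\<bar>z $ k - z' $ k\<bar> \<le> 2 * real CARD('m) / real M" for k
    using near[of k] far by (cases "k = i0") auto
  then show ?thesis using that z by blast
qed

text \<open>A spanning set falls under the volume bound. Otherwise its image under \<open>L\<close>
  lies in a hyperplane, where too many points would include a pair closer than the separation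
  allows. The sum of the two bounds covers both cases.\<close>

lemma card_separated_lattice_points:
  fixes F :: "(real^'m::{finite,wellorder}) set" and L :: "real^'m::_^'m::_" and M :: nat
  assumes fin: "finite F" and F: "F \<subseteq> int_lattice"
    and L: "det L \<noteq> 0" "\<And>x k. x \<in> F \<Longrightarrow> \<bar>(L *v x) $ k\<bar> \<le> 1"
    and M: "M > 0"
    and sep: "\<And>x y. x \<in> F \<Longrightarrow> y \<in> F \<Longrightarrow> x \<noteq> y \<Longrightarrow>
                \<exists>k. \<bar>(L *v (x - y)) $ k\<bar> > 2 * real CARD('m) / real M"
  shows "real (card F) \<le> 4 ^ CARD('m) * fact CARD('m) / \<bar>det L\<bar> + (real M + 1) ^ (CARD('m) - 1)"
proof (cases "span F = UNIV")
  case True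
  have "0 \<le> (real M + 1) ^ (CARD('m) - 1)" by simp
  then show ?thesis using card_le_of_span_UNIV[OF fin F True L] by linarith
next
  case False
  let ?G = "(\<lambda>x. L *v x) ` F"
  have inj: "inj (\<lambda>x. L *v x)" using L(1) det_nz_iff_inj[of "\<lambda>x. L *v x"] by simp
  have "span ?G \<noteq> UNIV"
  proof
    assume "span ?G = UNIV"
    then have "(\<lambda>x. L *v x) ` span F = (\<lambda>x. L *v x) ` UNIV"
      using inj linear_inj_imp_surj[of "\<lambda>x. L *v x"] by (simp add: linear_span_image)
    then show False using False inj by (simp add: inj_image_eq_iff)
  qed
  then obtain a where a: "a \<noteq> 0" "\<And>z. z \<in> ?G \<Longrightarrow> a \<bullet> z = 0"
    using span_not_univ_subset_hyperplane[of ?G] span_superset[of ?G] by blast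
  have "card ?G \<le> (M + 1) ^ (CARD('m) - 1)"
  proof (rule ccontr)
    assume *: "\<not> ?thesis"
    obtain z z' where z: "z \<in> ?G" "z' \<in> ?G" "z \<noteq> z'"
      "\<And>k. \<bar>z $ k - z' $ k\<bar> \<le> 2 * real CARD('m) / real M"
      by (rule hyperplane_pigeonhole[of ?G M a]) (use * fin M a L(2) in auto)
    from z(1,2) obtain x y where xy: "x \<in> F" "y \<in> F" "z = L *v x" "z' = L *v y" by auto
    then obtain k where "\<bar>(L *v (x - y)) $ k\<bar> > 2 * real CARD('m) / real M" using sep z(3) by blast
    then show False using z(4)[of k] by (simp add: xy matrix_vector_mult_diff_distrib)
  qed
  moreover have "card ?G = card F" by (rule card_image) (use inj in \<open>auto simp: inj_def inj_on_def\<close>)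
  ultimately have "real (card F) \<le> real ((M + 1) ^ (CARD('m) - 1))" by linarith
  moreover have "0 \<le> 4 ^ CARD('m) * fact CARD('m) / \<bar>det L\<bar>" by simp
  ultimately show ?thesis by (simp only: of_nat_power of_nat_add of_nat_1)
qed

subsection \<open>The lattice of a linear form\<close>

text \<open>Indexes the coordinates of pairs of an integer \<open>p\<close> and an integer vector
  \<open>q\<close>: \<open>Extra\<close> belongs to \<open>p\<close>, \<open>Coord i\<close> to
  \<open>q $ i\<close>.\<close>

datatype 'n aug = Extra | Coord 'n

lemma UNIV_aug: "UNIV = insert Extra (range Coord)"
  by (auto intro: aug.exhaust)

instance aug :: (finite) finite
  by standard (simp add: UNIV_aug)

lemma sum_aug: "sum f (UNIV :: 'n::finite aug set) = f Extra + (\<Sum>i\<in>UNIV. f (Coord i))"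
  by (simp add: UNIV_aug image_iff sum.reindex inj_on_def)

lemma prod_aug: "prod f (UNIV :: 'n::finite aug set) = f Extra * (\<Prod>i\<in>UNIV. f (Coord i))"
  by (simp add: UNIV_aug image_iff prod.reindex inj_on_def)

lemma card_aug: "CARD('n::finite aug) = CARD('n) + 1"
  using sum_aug[of "\<lambda>_. 1 :: nat"] by simp

text \<open>The order is arbitrary; it is needed only because the change of variables
  formula \<open>measure_linear_image\<close> is stated for well-ordered index types.\<close>

instantiation aug :: (finite) wellorder
begin

definition less_eq_aug :: "'a aug \<Rightarrow> 'a aug \<Rightarrow> bool" where
  "(x :: 'a aug) \<le> y \<longleftrightarrow> to_nat x \<le> to_nat y"

definition less_aug :: "'a aug \<Rightarrow> 'a aug \<Rightarrow> bool" where
  "(x :: 'a aug) < y \<longleftrightarrow> to_nat x < to_nat y"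

instance
proof
  fix P :: "'a aug \<Rightarrow> bool" and a
  assume step: "\<And>x. (\<And>y. y < x \<Longrightarrow> P y) \<Longrightarrow> P x"
  show "P a"
    by (induction a rule: measure_induct_rule[of to_nat]) (rule step, simp add: less_aug_def)
qed (auto simp: less_eq_aug_def less_aug_def)

end

text \<open>The image of the integer points under this matrix is the lattice of the vectors
  \<open>(\<alpha> \<bullet> q + p, q)\<close>, rescaled so that the box \<open>[-t, t] \<times> [-Q, Q]^N\<close> becomes the unit cube.\<close>

definition aug_matrix :: "real^'n \<Rightarrow> real \<Rightarrow> real \<Rightarrow> real^'n aug^'n aug" where
  "aug_matrix \<alpha> Q t = (\<chi> k l. case k of
      Extra \<Rightarrow> (case l of Extra \<Rightarrow> 1 / t | Coord i \<Rightarrow> \<alpha> $ i / t)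
    | Coord i \<Rightarrow> if l = Coord i then 1 / Q else 0)"

lemma aug_matrix_mult:
  "(aug_matrix \<alpha> Q t *v v) $ Extra = (v $ Extra + \<alpha> \<bullet> (\<chi> i. v $ Coord i)) / t"
  "(aug_matrix \<alpha> Q t *v v) $ Coord i = v $ Coord i / Q"
proof -
  show "(aug_matrix \<alpha> Q t *v v) $ Extra = (v $ Extra + \<alpha> \<bullet> (\<chi> i. v $ Coord i)) / t"
    by (simp add: aug_matrix_def matrix_vector_mult_def sum_aug inner_vec_def add_divide_distrib
        sum_divide_distrib)
  have "(\<Sum>j\<in>UNIV. (if j = i then 1 / Q else 0) * v $ Coord j) =
      (\<Sum>j\<in>UNIV. if j = i then v $ Coord j / Q else 0)"
    by (intro sum.cong) auto
  then show "(aug_matrix \<alpha> Q t *v v) $ Coord i = v $ Coord i / Q"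
    by (simp add: aug_matrix_def matrix_vector_mult_def sum_aug)
qed

text \<open>Factoring \<open>1 / t\<close> and \<open>1 / Q\<close> out of the rows leaves the
  identity with a combination \<open>x\<close> of its other rows added to row \<open>Extra\<close>,
  which does not change the determinant.\<close>

lemma det_aug_matrix: "det (aug_matrix (\<alpha> :: real^'n) Q t) = 1 / (t * Q ^ CARD('n))"
proof -
  let ?I = "mat 1 :: real^'n aug^'n aug"
  define x where "x = (\<Sum>i\<in>UNIV. \<alpha> $ i *s row (Coord i) ?I)"
  define c where "c = (\<lambda>k :: 'n aug. case k of Extra \<Rightarrow> 1 / t | Coord i \<Rightarrow> 1 / Q)"
  define R where "R = (\<lambda>k. if k = Extra then row Extra ?I + x else row k ?I)"
  have x: "x $ Extra = 0" "x $ Coord j = \<alpha> $ j" for j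
  proof -
    have "(\<Sum>i\<in>UNIV. \<alpha> $ i * (if i = j then 1 else 0)) = (\<Sum>i\<in>UNIV. if i = j then \<alpha> $ i else 0)"
      by (intro sum.cong) auto
    then show "x $ Coord j = \<alpha> $ j" by (simp add: x_def row_def mat_def)
  qed (simp add: x_def row_def mat_def)
  have "aug_matrix \<alpha> Q t $ k $ l = (c k *s R k) $ l" for k l
    by (cases k; cases l) (auto simp: aug_matrix_def c_def R_def x row_def mat_def)
  then have "aug_matrix \<alpha> Q t = (\<chi> k. c k *s R k)"
    by (simp add: vec_eq_iff)
  then have "det (aug_matrix \<alpha> Q t) = prod c UNIV * det (\<chi> k. R k)"
    by (simp only: det_rows_mul)
  moreover have "x \<in> vec.span {row j ?I |j. j \<noteq> Extra}"
    unfolding x_def by (intro vec.span_sum vec.span_scale vec.span_base CollectI exI conjI) auto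
  then have "det (\<chi> k. R k) = det ?I"
    unfolding R_def by (rule det_row_span)
  moreover have "prod c UNIV = 1 / (t * Q ^ CARD('n))"
    by (simp add: prod_aug power_divide c_def)
  ultimately show ?thesis by simp
qed

section \<open>Integer points of the cube with small distance to the nearest integer\<close>

lemma dist_nint_le: "dist_nint x \<le> \<bar>x - of_int m\<bar>"
  unfolding dist_nint_def by (rule round_diff_minimal)

lemma infnorm_le_cart:
  fixes x :: "real^'n"
  assumes "\<And>i. \<bar>x $ i\<bar> \<le> c"
  shows "infnorm x \<le> c"
  unfolding infnorm_cart by (rule cSup_least) (use assms in auto)

lemma mem_centered_cube: "q \<in> centered_cube Q \<longleftrightarrow> (\<forall>i. \<bar>q $ i\<bar> \<le> Q)"
  by (auto simp: centered_cube_def mem_box_cart abs_le_iff) (metis minus_le_iff)+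

lemma finite_centered_cube_int_lattice:
  "finite (centered_cube Q \<inter> int_lattice :: (real^'n) set)"
proof (rule finite_subset)
  show "centered_cube Q \<inter> int_lattice \<subseteq> (\<lambda>f :: 'n \<Rightarrow> int. \<chi> i. of_int (f i)) ` (UNIV \<rightarrow>\<^sub>E {- \<lceil>Q\<rceil>..\<lceil>Q\<rceil>})"
  proof
    fix q :: "real^'n"
    assume q: "q \<in> centered_cube Q \<inter> int_lattice"
    then have fl: "of_int \<lfloor>q $ i\<rfloor> = q $ i" for i by (auto simp: int_lattice_def)
    have "\<lfloor>q $ i\<rfloor> \<in> {- \<lceil>Q\<rceil>..\<lceil>Q\<rceil>}" for i
    proof -
      have "\<bar>q $ i\<bar> \<le> Q" using q by (auto simp: mem_centered_cube)
      then have "\<bar>real_of_int \<lfloor>q $ i\<rfloor>\<bar> \<le> Q" by (simp only: fl)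
      then show ?thesis by (simp add: abs_le_iff) linarith
    qed
    then show "q \<in> (\<lambda>f :: 'n \<Rightarrow> int. \<chi> i. of_int (f i)) ` (UNIV \<rightarrow>\<^sub>E {- \<lceil>Q\<rceil>..\<lceil>Q\<rceil>})"
      by (intro image_eqI[of _ _ "\<lambda>i. \<lfloor>q $ i\<rfloor>"]) (auto simp: vec_eq_iff fl)
  qed
qed (simp add: finite_PiE)

text \<open>Monotonicity replaces \<open>\<phi> (infnorm q)\<close> by the common value
  \<open>\<phi> Q\<close>. The radius \<open>R\<close> is separate from \<open>Q\<close> because
  differences of close points need a smaller one.\<close>

lemma badly_approximable_le:
  assumes ba: "badly_approximable \<phi> \<alpha>" and anti: "antimono_on {0<..} \<phi>"
    and q: "q \<in> int_lattice" "q \<noteq> 0" and R: "infnorm q \<le> R" "infnorm q \<le> Q"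
  shows "\<phi> Q \<le> R ^ CARD('n) * dist_nint ((\<alpha> :: real^'n) \<bullet> q)"
proof -
  have "\<phi> Q \<le> \<phi> (infnorm q)"
    using q R infnorm_pos_lt[of q] by (intro monotone_onD[OF anti]) auto
  also have "\<dots> \<le> infnorm q ^ CARD('n) * dist_nint (\<alpha> \<bullet> q)"
    using ba q by (auto simp: badly_approximable_def)
  also have "\<dots> \<le> R ^ CARD('n) * dist_nint (\<alpha> \<bullet> q)"
    using R infnorm_pos_le[of q] by (intro mult_right_mono power_mono) (auto simp: dist_nint_def)
  finally show ?thesis .
qed

text \<open>Two points of the lattice that are closer than \<open>(\<delta> / t) powr (1 / (N + 1))\<close> in the rescaled
  maximum norm would have a difference \<open>q\<close> with \<open>infnorm q \<le> Q\<close> contradicting bad approximability.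
  The scale being at most 1, no value of \<open>\<phi>\<close> beyond \<open>Q\<close> enters.\<close>

lemma card_small_dist_le:
  fixes \<alpha> :: "real^'n"
  assumes \<phi>: "\<phi> Q > 0" and anti: "antimono_on {0<..} \<phi>" and ba: "badly_approximable \<phi> \<alpha>"
    and Q: "Q \<ge> 1" and \<delta>: "\<delta> = \<phi> Q / Q ^ CARD('n)" and t: "\<delta> \<le> t"
  shows "real (card {q \<in> centered_cube Q \<inter> int_lattice - {0}. dist_nint (\<alpha> \<bullet> q) \<le> t})
    \<le> 4 ^ (CARD('n) + 1) * fact (CARD('n) + 1) * (t * Q ^ CARD('n))
      + (2 * real CARD('n) + 4) ^ CARD('n) * (t / \<delta>) powr (CARD('n) / (CARD('n) + 1))"
proof -
  define n where "n = CARD('n) + 1"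
  have n: "CARD('n aug) = n" by (simp add: card_aug n_def)
  have \<delta>0: "\<delta> > 0" using \<phi> Q by (simp add: \<delta>)
  then have t0: "t > 0" using t by linarith
  \<comment> \<open>This choice makes \<open>Q ^ N * t * \<theta> ^ (N + 1)\<close> equal to
    \<open>\<phi> Q\<close>, with \<open>N = CARD('n)\<close>: below the scale
    \<open>\<theta>\<close>, bad approximability excludes close pairs.\<close>
  define \<theta> where "\<theta> = (\<delta> / t) powr (1 / real n)"
  have \<theta>0: "\<theta> > 0" using \<delta>0 t0 by (simp add: \<theta>_def)
  have \<theta>1: "\<theta> \<le> 1" using \<delta>0 t0 t by (simp add: \<theta>_def powr_le1)
  have n0: "n > 0" by (simp add: n_def)
  have \<theta>n: "\<theta> ^ n = \<delta> / t"
    using \<delta>0 t0 n0 by (simp add: \<theta>_def powr_powr flip: powr_realpow)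
  have "\<theta> ^ CARD('n) = (\<delta> / t) powr (CARD('n) / n)"
    using \<delta>0 t0 by (simp add: \<theta>_def powr_powr flip: powr_realpow)
  then have \<theta>N: "1 / \<theta> ^ CARD('n) = (t / \<delta>) powr (CARD('n) / (CARD('n) + 1))"
    using \<delta>0 t0 by (simp add: powr_divide n_def add.commute)
  \<comment> \<open>The \<open>+ 1\<close> makes \<open>M\<close> strictly larger than
    \<open>2 * n / \<theta>\<close>, so that the spacing \<open>\<eta>\<close> is strictly below
    \<open>\<theta>\<close>.\<close>
  define M where "M = nat \<lfloor>2 * real n / \<theta>\<rfloor> + 1"
  have M0: "M > 0" by (simp add: M_def)
  have M1: "2 * real n / \<theta> < real M" using \<theta>0 by (simp add: M_def) linarith
  have M2: "real M \<le> 2 * real n / \<theta> + 1" using \<theta>0 by (simp add: M_def)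
  define \<eta> where "\<eta> = 2 * real n / real M"
  have \<eta>: "\<eta> < \<theta>" "\<eta> > 0" using M1 M0 \<theta>0 by (auto simp: \<eta>_def field_simps n_def)
  \<comment> \<open>As \<open>\<theta> \<le> 1\<close>, the additive 2 is absorbed;
    \<open>2 * n + 2 = 2 * CARD('n) + 4\<close> is the base in the statement.\<close>
  have "1 + 1 \<le> 2 / \<theta>" using \<theta>0 \<theta>1 by (simp add: field_simps)
  then have "real M + 1 \<le> (2 * real n + 2) / \<theta>" using M2 by (simp add: add_divide_distrib)
  then have "(real M + 1) ^ CARD('n) \<le> ((2 * real n + 2) / \<theta>) ^ CARD('n)"
    by (intro power_mono) auto
  also have "\<dots> = (2 * real n + 2) ^ CARD('n) * (1 / \<theta> ^ CARD('n))"
    by (simp add: power_divide)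
  finally have Mpow: "(real M + 1) ^ CARD('n) \<le>
      (2 * real CARD('n) + 4) ^ CARD('n) * (t / \<delta>) powr (CARD('n) / (CARD('n) + 1))"
    unfolding \<theta>N by (simp add: n_def algebra_simps)
  define E where "E = {q \<in> centered_cube Q \<inter> int_lattice - {0}. dist_nint (\<alpha> \<bullet> q) \<le> t}"
  \<comment> \<open>With \<open>p\<close> minus the nearest integer,
    \<open>\<alpha> \<bullet> q + p\<close> is the signed distance, so \<open>L\<close> sends
    \<open>lift q\<close> into the unit cube for \<open>q\<close> in \<open>E\<close>.\<close>
  define lift where "lift = (\<lambda>q. (\<chi> k. case k of Extra \<Rightarrow> - of_int (round (\<alpha> \<bullet> q)) | Coord i \<Rightarrow> q $ i) :: real^'n aug)"
  have lift_simps [simp]: "lift q $ Extra = - of_int (round (\<alpha> \<bullet> q))" "lift q $ Coord i = q $ i" for q i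
    by (simp_all add: lift_def)
  have inj: "inj_on lift E"
  proof (rule inj_onI)
    fix p q assume "lift p = lift q"
    then have "lift p $ Coord i = lift q $ Coord i" for i by simp
    then show "p = q" by (simp add: vec_eq_iff)
  qed
  have finE: "finite E"
    unfolding E_def by (rule finite_subset[OF _ finite_centered_cube_int_lattice]) auto
  define L where "L = aug_matrix \<alpha> Q t"
  have "real (card (lift ` E)) \<le> 4 ^ CARD('n aug) * fact CARD('n aug) / \<bar>det L\<bar> + (real M + 1) ^ (CARD('n aug) - 1)"
  proof (rule card_separated_lattice_points)
    show "finite (lift ` E)" using finE by simp
    show "lift ` E \<subseteq> int_lattice"
    proof (clarsimp simp: int_lattice_def E_def)
      fix q :: "real^'n" and k :: "'n aug" assume "\<forall>i. q $ i \<in> \<int>"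
      then show "lift q $ k \<in> \<int>" by (cases k) auto
    qed
    show "det L \<noteq> 0" using t0 Q by (simp add: L_def det_aug_matrix)
    show "M > 0" by (rule M0)
  next
    fix x k assume "x \<in> lift ` E"
    then obtain q where q: "q \<in> E" "x = lift q" by auto
    show "\<bar>(L *v x) $ k\<bar> \<le> 1"
    proof (cases k)
      case Extra
      have "\<bar>\<alpha> \<bullet> q - of_int (round (\<alpha> \<bullet> q))\<bar> \<le> t"
        using q by (simp add: E_def dist_nint_def)
      then show ?thesis using t0 q(2) by (simp add: Extra L_def aug_matrix_mult)
    next
      case (Coord i)
      then show ?thesis using Q q by (simp add: L_def aug_matrix_mult E_def mem_centered_cube)
    qed
  next
    fix x y assume "x \<in> lift ` E" "y \<in> lift ` E" and ne: "x \<noteq> y"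
    then obtain p q where pq: "p \<in> E" "x = lift p" "q \<in> E" "y = lift q" by auto
    show "\<exists>k. \<bar>(L *v (x - y)) $ k\<bar> > 2 * real CARD('n aug) / real M"
    proof (rule ccontr)
      assume "\<not> ?thesis"
      then have close: "\<bar>(L *v (x - y)) $ k\<bar> \<le> \<eta>" for k by (auto simp: n \<eta>_def not_less)
      define d where "d = p - q"
      have d: "d \<in> int_lattice" "d \<noteq> 0"
        using pq ne by (auto simp: d_def E_def int_lattice_def)
      have "\<bar>d $ i\<bar> \<le> Q * \<eta>" for i
        using close[of "Coord i"] Q by (simp add: L_def aug_matrix_mult pq d_def field_simps)
      then have R: "infnorm d \<le> Q * \<eta>" by (rule infnorm_le_cart)
      also have "Q * \<eta> \<le> Q" using \<eta> \<theta>1 Q by (simp add: mult_left_le)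
      finally have "infnorm d \<le> Q" .
      have "(\<chi> i. (x - y) $ Coord i) = d" by (simp add: d_def pq vec_eq_iff)
      then have "\<bar>\<alpha> \<bullet> d - of_int (round (\<alpha> \<bullet> p) - round (\<alpha> \<bullet> q))\<bar> \<le> t * \<eta>"
        using close[of Extra] t0 by (simp add: L_def aug_matrix_mult pq field_simps)
      then have "dist_nint (\<alpha> \<bullet> d) \<le> t * \<eta>"
        using dist_nint_le order_trans by blast
      \<comment> \<open>A close pair would give
        \<open>\<phi> Q \<le> Q ^ N * t * \<eta> ^ (N + 1)\<close>, whereas the same expression with
        the larger \<open>\<theta>\<close> is exactly \<open>\<phi> Q\<close>.\<close>
      have "\<phi> Q \<le> (Q * \<eta>) ^ CARD('n) * dist_nint (\<alpha> \<bullet> d)"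
        by (rule badly_approximable_le) fact+
      also have "\<dots> \<le> (Q * \<eta>) ^ CARD('n) * (t * \<eta>)"
        using \<open>dist_nint _ \<le> t * \<eta>\<close> Q \<eta> by (intro mult_left_mono) auto
      also have "\<dots> = Q ^ CARD('n) * t * \<eta> ^ n" by (simp add: n_def power_mult_distrib)
      also have "\<dots> < Q ^ CARD('n) * t * \<theta> ^ n"
        using Q t0 \<eta> by (intro mult_strict_left_mono power_strict_mono) (auto simp: n_def)
      also have "\<dots> = \<phi> Q" using t0 Q by (simp add: \<theta>n \<delta>)
      finally show False by simp
    qed
  qed
  then have "real (card E) \<le> 4 ^ n * fact n * (t * Q ^ CARD('n)) + (real M + 1) ^ CARD('n)"
    using t0 Q by (simp add: card_image[OF inj] n L_def det_aug_matrix) (simp add: n_def)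
  then show ?thesis
    using Mpow unfolding n_def E_def by linarith
qed

subsection \<open>Sums of reciprocals\<close>

lemma exists_dyadic_interval:
  fixes x \<delta> :: real
  shows "\<delta> \<le> x \<Longrightarrow> x < \<delta> * 2 ^ J \<Longrightarrow> \<exists>j<J. \<delta> * 2 ^ j \<le> x \<and> x < \<delta> * 2 ^ Suc j"
proof (induction J)
  case (Suc J)
  then show ?case by (cases "x < \<delta> * 2 ^ J") (auto simp: less_Suc_eq)
qed simp

text \<open>Each reciprocal is at most that of the lower end of its dyadic interval. Sublevel sets,
  being what the counting lemma bounds, replace the intervals; this only adds nonnegative
  terms.\<close>

lemma sum_inverse_le_dyadic:
  fixes d :: "'a \<Rightarrow> real"
  assumes fin: "finite S" and \<delta>: "\<delta> > 0"
    and d: "\<And>q. q \<in> S \<Longrightarrow> \<delta> \<le> d q \<and> d q < \<delta> * 2 ^ J"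
  shows "(\<Sum>q\<in>S. inverse (d q)) \<le> (\<Sum>j<J. real (card {q \<in> S. d q \<le> \<delta> * 2 ^ Suc j}) / (\<delta> * 2 ^ j))"
proof -
  define w where "w = (\<lambda>q j. if d q \<le> \<delta> * 2 ^ Suc j then 1 / (\<delta> * 2 ^ j) else 0)"
  have "(\<Sum>q\<in>S. inverse (d q)) \<le> (\<Sum>q\<in>S. \<Sum>j<J. w q j)"
  proof (rule sum_mono)
    fix q assume "q \<in> S"
    then obtain j where j: "j < J" "\<delta> * 2 ^ j \<le> d q" "d q < \<delta> * 2 ^ Suc j"
      using exists_dyadic_interval[of \<delta> "d q" J] d by blast
    have "inverse (d q) \<le> inverse (\<delta> * 2 ^ j)"
      using j(2) \<delta> by (intro le_imp_inverse_le) auto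
    also have "\<dots> = w q j" using j(3) by (simp add: w_def divide_inverse)
    also have "\<dots> \<le> (\<Sum>j<J. w q j)"
      using j(1) \<delta> by (intro member_le_sum) (auto simp: w_def)
    finally show "inverse (d q) \<le> (\<Sum>j<J. w q j)" .
  qed
  also have "\<dots> = (\<Sum>j<J. \<Sum>q\<in>S. w q j)" by (rule sum.swap)
  also have "\<dots> = (\<Sum>j<J. real (card {q \<in> S. d q \<le> \<delta> * 2 ^ Suc j}) / (\<delta> * 2 ^ j))"
    using fin by (intro sum.cong) (auto simp: w_def sum.If_cases Int_def)
  finally show ?thesis .
qed

text \<open>For fixed \<open>q\<close> the weights \<open>2 ^ j\<close> with
  \<open>d q \<le> 1 / 2 ^ j\<close> form a geometric sum, at most twice its largest term, which is
  at most \<open>inverse (d q)\<close>. Counts at many scales thus bound the sum from below.\<close>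

lemma sum_dyadic_card_le:
  fixes d :: "'a \<Rightarrow> real"
  assumes fin: "finite S" and d: "\<And>q. q \<in> S \<Longrightarrow> d q > 0"
  shows "(\<Sum>j<J. 2 ^ j * real (card {q \<in> S. d q \<le> 1 / 2 ^ j})) \<le> 2 * (\<Sum>q\<in>S. inverse (d q))"
proof -
  define w where "w = (\<lambda>q j. if d q \<le> 1 / 2 ^ j then 2 ^ j else 0 :: real)"
  have pow: "(\<Sum>j<J. w q j) \<le> 2 ^ J" for q J
  proof (induction J)
    case (Suc J)
    have "w q J \<le> 2 ^ J" by (simp add: w_def)
    then show ?case using Suc by simp
  qed simp
  have w: "(\<Sum>j<J. w q j) \<le> 2 * inverse (d q)" if "q \<in> S" for q
  proof (induction J)
    case 0
    then show ?case using d[OF that] by simp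
  next
    case (Suc J)
    show ?case
    proof (cases "d q \<le> 1 / 2 ^ J")
      case True
      then have "2 ^ Suc J \<le> 2 * inverse (d q)"
        using d[OF that] by (simp add: field_simps)
      then show ?thesis using pow[of q "Suc J"] by linarith
    next
      case False
      then show ?thesis using Suc by (simp add: w_def)
    qed
  qed
  have "(\<Sum>j<J. 2 ^ j * real (card {q \<in> S. d q \<le> 1 / 2 ^ j})) = (\<Sum>j<J. \<Sum>q\<in>S. w q j)"
    using fin by (intro sum.cong) (auto simp: w_def sum.If_cases Int_def)
  also have "\<dots> = (\<Sum>q\<in>S. \<Sum>j<J. w q j)" by (rule sum.swap)
  also have "\<dots> \<le> (\<Sum>q\<in>S. 2 * inverse (d q))" by (intro sum_mono w)
  finally show ?thesis by (simp add: sum_distrib_left)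
qed

section \<open>The lower bound by Dirichlet's pigeonhole argument\<close>

lemma dirichlet_count:
  fixes \<alpha> :: "real^'n"
  assumes Q: "Q \<ge> 1" and M: "M > 0"
  shows "Q ^ CARD('n) / real M - 1
    \<le> real (card {q \<in> centered_cube Q \<inter> int_lattice - {0}. dist_nint (\<alpha> \<bullet> q) \<le> 1 / real M})"
proof -
  define E where "E = {q \<in> centered_cube Q \<inter> int_lattice - {0}. dist_nint (\<alpha> \<bullet> q) \<le> 1 / real M}"
  define v where "v = (\<lambda>f :: 'n \<Rightarrow> nat. (\<chi> i. real (f i)) :: real^'n)"
  \<comment> \<open>Entries are restricted to [0, Q], so that differences stay in the cube.\<close>
  define P where "P = v ` (UNIV \<rightarrow>\<^sub>E {0..nat \<lfloor>Q\<rfloor>})"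
  have "inj v" by (auto simp: inj_def v_def vec_eq_iff)
  then have cardP: "card P = (nat \<lfloor>Q\<rfloor> + 1) ^ CARD('n)"
    by (simp add: P_def card_image inj_on_subset card_PiE)
  have finP: "finite P" by (simp add: P_def finite_PiE)
  define f where "f = (\<lambda>q. nat \<lfloor>frac (\<alpha> \<bullet> q) * real M\<rfloor>)"
  have "f q < M" for q
  proof -
    have "frac (\<alpha> \<bullet> q) * real M < 1 * real M"
      using M by (intro mult_strict_right_mono frac_lt_1) auto
    then show ?thesis using M by (simp add: f_def nat_less_iff floor_less_iff)
  qed
  then have "f \<in> P \<rightarrow> {..<M}" by auto
  from pigeonhole_card[OF this finP] obtain y where y: "card P \<le> card (f -` {y} \<inter> P) * M"
    using M by auto
  define G where "G = f -` {y} \<inter> P"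
  have "card P > 0" by (simp add: cardP)
  then have "G \<noteq> {}" using y unfolding G_def by (metis card.empty mult_0 not_le)
  then obtain q0 where q0: "q0 \<in> G" by auto
  have finG: "finite G" using finP by (simp add: G_def)
  \<comment> \<open>Points of one class have fractional parts within \<open>1 / M\<close>, so
    differences from a fixed member \<open>q0\<close> belong to \<open>E\<close>. Only the
    difference 0 is lost, which accounts for the \<open>- 1\<close>.\<close>
  have "(\<lambda>q. q - q0) ` (G - {q0}) \<subseteq> E"
  proof (rule image_subsetI)
    fix q assume "q \<in> G - {q0}"
    then have q: "q \<in> G" "q \<noteq> q0" by auto
    have P: "0 \<le> p $ i \<and> p $ i \<le> Q \<and> p $ i \<in> \<int>" if "p \<in> P" for p i
    proof -
      from that obtain g where g: "g \<in> UNIV \<rightarrow>\<^sub>E {0..nat \<lfloor>Q\<rfloor>}" "p = v g" by (auto simp: P_def)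
      then have "g i \<le> nat \<lfloor>Q\<rfloor>" by (auto simp: PiE_def Pi_def)
      then have "real (g i) \<le> Q" using Q by linarith
      then show ?thesis by (simp add: g v_def)
    qed
    have "\<bar>(q - q0) $ i\<bar> \<le> Q" for i
      using P[of q i] P[of q0 i] q q0 by (auto simp: G_def abs_le_iff)
    moreover have "q - q0 \<in> int_lattice"
      using P q q0 by (auto simp: G_def int_lattice_def)
    moreover have "dist_nint (\<alpha> \<bullet> (q - q0)) \<le> 1 / real M"
    proof -
      have "nat \<lfloor>frac (\<alpha> \<bullet> q) * real M\<rfloor> = nat \<lfloor>frac (\<alpha> \<bullet> q0) * real M\<rfloor>"
        using q q0 by (simp add: G_def f_def)
      then have "\<lfloor>frac (\<alpha> \<bullet> q) * real M\<rfloor> = \<lfloor>frac (\<alpha> \<bullet> q0) * real M\<rfloor>"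
        by (simp add: nat_eq_iff)
      then have "\<bar>frac (\<alpha> \<bullet> q) * real M - frac (\<alpha> \<bullet> q0) * real M\<bar> \<le> 1" by linarith
      then have "\<bar>frac (\<alpha> \<bullet> q) - frac (\<alpha> \<bullet> q0)\<bar> * real M \<le> 1"
        by (simp add: abs_mult flip: left_diff_distrib)
      then have "\<bar>frac (\<alpha> \<bullet> q) - frac (\<alpha> \<bullet> q0)\<bar> \<le> 1 / real M"
        using M by (simp add: field_simps)
      also have "frac (\<alpha> \<bullet> q) - frac (\<alpha> \<bullet> q0) = \<alpha> \<bullet> (q - q0) - of_int (\<lfloor>\<alpha> \<bullet> q\<rfloor> - \<lfloor>\<alpha> \<bullet> q0\<rfloor>)"
        by (simp add: frac_def inner_diff_right)
      finally show ?thesis using dist_nint_le order_trans by blast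
    qed
    ultimately show "q - q0 \<in> E" using q(2) by (simp add: E_def mem_centered_cube)
  qed
  moreover have "finite E"
    unfolding E_def by (rule finite_subset[OF _ finite_centered_cube_int_lattice]) auto
  ultimately have "card ((\<lambda>q. q - q0) ` (G - {q0})) \<le> card E" by (intro card_mono) auto
  then have "card G - 1 \<le> card E" using q0 finG by (simp add: card_image)
  then have GE: "real (card G) - 1 \<le> real (card E)" by linarith
  have "Q ^ CARD('n) \<le> (real (nat \<lfloor>Q\<rfloor>) + 1) ^ CARD('n)"
    using Q by (intro power_mono) linarith+
  also have "\<dots> = real (card P)" by (simp add: cardP add.commute)
  also have "\<dots> \<le> real (card G * M)" using y unfolding G_def by (simp only: of_nat_le_iff)
  finally have "Q ^ CARD('n) / real M \<le> real (card G)" using M by (simp add: field_simps)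
  then show ?thesis using GE by (simp add: E_def)
qed

text \<open>At each scale \<open>1 / 2 ^ j\<close> Dirichlet's count contributes at least
  \<open>X - 2 ^ j\<close>, where \<open>X = Q ^ CARD('n)\<close>. Over about \<open>log 2 X\<close>
  scales the errors add up to at most \<open>X\<close>.\<close>

lemma sum_inverse_dist_ge:
  fixes \<alpha> :: "real^'n"
  assumes Q: "Q \<ge> 1"
    and pos: "\<And>q. q \<in> centered_cube Q \<inter> int_lattice - {0} \<Longrightarrow> dist_nint (\<alpha> \<bullet> q) > 0"
  shows "Q ^ CARD('n) * ln Q
    \<le> 64 * (\<Sum>q \<in> centered_cube Q \<inter> int_lattice - {0}. inverse (dist_nint (\<alpha> \<bullet> q)))"
proof -
  let ?S = "centered_cube Q \<inter> int_lattice - {0} :: (real^'n) set"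
  define \<Sigma> where "\<Sigma> = (\<Sum>q \<in> ?S. inverse (dist_nint (\<alpha> \<bullet> q)))"
  have finS: "finite ?S" using finite_centered_cube_int_lattice by blast
  define X where "X = Q ^ CARD('n)"
  have X1: "X \<ge> 1" using Q by (simp add: X_def)
  have lnX: "ln Q \<le> ln X"
    using Q self_le_power[of Q "CARD('n)"] by (simp add: X_def)
  have ln_log: "ln X \<le> log 2 X"
  proof -
    have "ln X * ln 2 \<le> ln X * 1" using X1 ln_2_less_1 by (intro mult_left_mono) auto
    then show ?thesis by (simp add: log_def field_simps)
  qed
  define J where "J = nat \<lfloor>log 2 X\<rfloor>"
  have log0: "log 2 X \<ge> 0" using X1 by simp
  have J1: "log 2 X - 1 \<le> real J" using log0 by (simp add: J_def)
  have "real J \<le> log 2 X" using log0 by (simp add: J_def)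
  then have "2 powr real J \<le> 2 powr (log 2 X)" by simp
  then have J2: "2 ^ J \<le> X" using X1 by (simp add: powr_realpow)
  have "real J * X - 2 ^ J \<le> (\<Sum>j<J. 2 ^ j * (X / 2 ^ j - 1))"
  proof -
    have "(\<Sum>j<J. 2 ^ j * (X / 2 ^ j - 1)) = real J * X - (\<Sum>j<J. 2 ^ j)"
      by (simp add: right_diff_distrib sum_subtractf)
    moreover have "(\<Sum>j<J. 2 ^ j) \<le> (2 ^ J :: real)" by (induction J) auto
    ultimately show ?thesis by linarith
  qed
  also have "\<dots> \<le> (\<Sum>j<J. 2 ^ j * real (card {q \<in> ?S. dist_nint (\<alpha> \<bullet> q) \<le> 1 / 2 ^ j}))"
  proof (intro sum_mono mult_left_mono)
    fix j
    show "X / 2 ^ j - 1 \<le> real (card {q \<in> ?S. dist_nint (\<alpha> \<bullet> q) \<le> 1 / 2 ^ j})"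
      using dirichlet_count[OF Q, of "2 ^ j" \<alpha>] by (simp add: X_def)
  qed simp
  also have "\<dots> \<le> 2 * \<Sigma>"
    unfolding \<Sigma>_def by (rule sum_dyadic_card_le[OF finS pos])
  finally have main: "real J * X - X \<le> 2 * \<Sigma>" using J2 by linarith
  have "(log 2 X - 1) * X \<le> real J * X" using J1 X1 by (intro mult_right_mono) auto
  then have main': "(log 2 X - 2) * X \<le> 2 * \<Sigma>" using main by (simp add: algebra_simps)
  \<comment> \<open>A single unit vector gives this; it serves for small \<open>X\<close>, where
    \<open>main'\<close> says too little.\<close>
  have \<Sigma>1: "\<Sigma> \<ge> 1"
  proof -
    let ?e = "axis undefined 1 :: real^'n"
    have e: "?e \<in> ?S" using Q by (auto simp: mem_centered_cube int_lattice_def axis_def vec_eq_iff)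
    have "dist_nint (\<alpha> \<bullet> ?e) \<le> 1"
      using of_int_round_abs_le[of "\<alpha> \<bullet> ?e"] by (simp add: dist_nint_def abs_minus_commute)
    then have "1 \<le> inverse (dist_nint (\<alpha> \<bullet> ?e))" using pos[OF e] by (simp add: one_le_inverse)
    also have "\<dots> \<le> \<Sigma>"
      unfolding \<Sigma>_def
    proof (rule member_le_sum[OF e _ finS])
      fix q assume "q \<in> ?S - {?e}"
      then have "0 < dist_nint (\<alpha> \<bullet> q)" by (intro pos) blast
      then show "0 \<le> inverse (dist_nint (\<alpha> \<bullet> q))" by simp
    qed
    finally show ?thesis .
  qed
  \<comment> \<open>Once \<open>log 2 X \<ge> 4\<close>, subtracting 2 costs at most a factor 2.
    Below that, \<open>X \<le> 16\<close> and \<open>ln Q \<le> 4\<close>, whence the constant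
    64.\<close>
  have "X * ln Q \<le> 64 * \<Sigma>"
  proof (cases "log 2 X \<ge> 4")
    case True
    have "X * ln Q \<le> log 2 X * X" using lnX ln_log X1 by (simp add: mult.commute)
    also have "\<dots> \<le> 2 * (log 2 X - 2) * X" using True X1 by (intro mult_right_mono) auto
    also have "\<dots> = 2 * ((log 2 X - 2) * X)" by (simp only: mult.assoc)
    also have "\<dots> \<le> 4 * \<Sigma>" using main' by linarith
    finally show ?thesis using \<Sigma>1 by linarith
  next
    case False
    then have "X < 2 powr 4" using X1 log_less_iff[of 2 X 4] by linarith
    also have "2 powr 4 = (16 :: real)" by simp
    finally have "X \<le> 16" by simp
    moreover have "ln Q \<le> 4" using False lnX ln_log by linarith
    ultimately have "X * ln Q \<le> 16 * 4" using Q by (intro mult_mono) auto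
    then show ?thesis using \<Sigma>1 by linarith
  qed
  then show ?thesis by (simp add: X_def \<Sigma>_def)
qed

section \<open>The upper bound by dyadic summation\<close>

lemma sum_inverse_dist_le:
  fixes \<alpha> :: "real^'n"
  assumes \<phi>: "0 < \<phi> Q" "\<phi> Q \<le> 1" and anti: "antimono_on {0<..} \<phi>" and ba: "badly_approximable \<phi> \<alpha>"
    and Q: "Q \<ge> 1"
    and C1: "C1 = 4 ^ (CARD('n) + 1) * fact (CARD('n) + 1)"
    and C2: "C2 = (2 * real CARD('n) + 4) ^ CARD('n)"
    and \<rho>: "\<rho> = 2 powr (- (1 / (real CARD('n) + 1)))"
  shows "(\<Sum>q \<in> centered_cube Q \<inter> int_lattice - {0}. inverse (dist_nint (\<alpha> \<bullet> q)))
    \<le> (4 * real CARD('n) * C1 + 6 * C1 + 2 * C2 / (1 - \<rho>)) * (Q ^ CARD('n) * ln Q + Q ^ CARD('n) / \<phi> Q)"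
proof -
  let ?S = "centered_cube Q \<inter> int_lattice - {0} :: (real^'n) set"
  define \<kappa> where "\<kappa> = CARD('n) / (CARD('n) + 1)"
  define X where "X = Q ^ CARD('n)"
  have X1: "X \<ge> 1" using Q by (simp add: X_def)
  define \<delta> where "\<delta> = \<phi> Q / X"
  have \<delta>0: "\<delta> > 0" using \<phi> X1 by (simp add: \<delta>_def)
  have \<delta>1: "\<delta> \<le> 1" using \<phi> X1 by (simp add: \<delta>_def)
  have finS: "finite ?S" using finite_centered_cube_int_lattice by blast
  \<comment> \<open>Enough doublings to lead from \<open>\<delta>\<close> beyond 1 and hence beyond
    all distances.\<close>
  define J where "J = nat \<lfloor>log 2 (1 / \<delta>)\<rfloor> + 1"
  have log0: "log 2 (1 / \<delta>) \<ge> 0" using \<delta>0 \<delta>1 by simp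
  have "log 2 (1 / \<delta>) < real J" unfolding J_def using log0 by simp linarith
  then have "1 / \<delta> < 2 powr real J" using \<delta>0 by (simp add: log_less_iff)
  then have J2: "1 < \<delta> * 2 ^ J" using \<delta>0 by (simp add: powr_realpow field_simps)
  have J1: "real J \<le> log 2 (1 / \<delta>) + 1" unfolding J_def using log0 by simp
  have C: "C1 > 0" "C2 > 0" by (simp_all add: C1 C2 add_pos_pos)
  have d: "\<delta> \<le> dist_nint (\<alpha> \<bullet> q) \<and> dist_nint (\<alpha> \<bullet> q) < \<delta> * 2 ^ J" if q: "q \<in> ?S" for q
  proof
    have "infnorm q \<le> Q" using q by (intro infnorm_le_cart) (auto simp: mem_centered_cube)
    then have "\<phi> Q \<le> X * dist_nint (\<alpha> \<bullet> q)"
      unfolding X_def using badly_approximable_le[OF ba anti, of q Q Q] q by auto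
    then show "\<delta> \<le> dist_nint (\<alpha> \<bullet> q)" using X1 by (simp add: \<delta>_def field_simps)
    show "dist_nint (\<alpha> \<bullet> q) < \<delta> * 2 ^ J"
      using J2 of_int_round_abs_le[of "\<alpha> \<bullet> q"] by (simp add: dist_nint_def abs_minus_commute)
  qed
  have \<rho>01: "0 < \<rho>" "\<rho> < 1"
    unfolding \<rho> by (auto intro!: powr_less_one)
  \<comment> \<open>The count grows with exponent \<open>\<kappa> < 1\<close> while the reciprocals
    shrink like \<open>1 / 2 ^ j\<close>, which leaves a geometric series of ratio
    \<open>\<rho> = 2 powr (\<kappa> - 1)\<close>.\<close>
  have pw: "(2 ^ Suc j) powr \<kappa> / 2 ^ j \<le> 2 * \<rho> ^ j" for j
  proof -
    have "\<kappa> - 1 = - (1 / (real CARD('n) + 1))" by (simp add: \<kappa>_def field_simps)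
    then have "\<rho> ^ j = 2 powr (real j * (\<kappa> - 1))"
      by (simp add: \<rho> powr_powr mult.commute flip: powr_realpow)
    moreover have "(2 ^ Suc j) powr \<kappa> / 2 ^ j = 2 powr (real j * (\<kappa> - 1)) * 2 powr \<kappa>"
    proof -
      have "(2 ^ Suc j) powr \<kappa> / 2 ^ j = 2 powr (real (Suc j) * \<kappa>) / 2 powr (real j)"
        by (simp only: powr_realpow[symmetric, of 2] powr_powr zero_less_numeral)
      also have "\<dots> = 2 powr (real j * (\<kappa> - 1) + \<kappa>)"
        by (simp add: powr_diff[symmetric] algebra_simps)
      finally show ?thesis by (simp add: powr_add)
    qed
    moreover have "2 powr \<kappa> \<le> 2 powr 1" unfolding \<kappa>_def by (intro powr_mono) auto
    ultimately show ?thesis using \<rho>01 by (simp add: mult.commute)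
  qed
  have "(\<Sum>q \<in> ?S. inverse (dist_nint (\<alpha> \<bullet> q)))
      \<le> (\<Sum>j<J. real (card {q \<in> ?S. dist_nint (\<alpha> \<bullet> q) \<le> \<delta> * 2 ^ Suc j}) / (\<delta> * 2 ^ j))"
    using finS \<delta>0 d by (rule sum_inverse_le_dyadic)
  also have "\<dots> \<le> (\<Sum>j<J. 2 * C1 * X + 2 * C2 / \<delta> * \<rho> ^ j)"
  proof (rule sum_mono)
    fix j
    have "\<delta> * 1 \<le> \<delta> * 2 ^ Suc j" using \<delta>0 by (intro mult_left_mono one_le_power) auto
    then have "real (card {q \<in> ?S. dist_nint (\<alpha> \<bullet> q) \<le> \<delta> * 2 ^ Suc j})
        \<le> C1 * (\<delta> * 2 ^ Suc j * X) + C2 * (\<delta> * 2 ^ Suc j / \<delta>) powr \<kappa>"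
      unfolding C1 C2 \<kappa>_def X_def
      by (intro card_small_dist_le[OF \<phi>(1) anti ba Q]) (auto simp: \<delta>_def X_def)
    also have "\<delta> * 2 ^ Suc j / \<delta> = 2 ^ Suc j" using \<delta>0 by simp
    finally have "real (card {q \<in> ?S. dist_nint (\<alpha> \<bullet> q) \<le> \<delta> * 2 ^ Suc j}) / (\<delta> * 2 ^ j)
        \<le> (C1 * (\<delta> * 2 ^ Suc j * X) + C2 * (2 ^ Suc j) powr \<kappa>) / (\<delta> * 2 ^ j)"
      using \<delta>0 by (intro divide_right_mono) auto
    also have "\<dots> = 2 * C1 * X + C2 / \<delta> * ((2 ^ Suc j) powr \<kappa> / 2 ^ j)"
      using \<delta>0 by (simp add: add_divide_distrib del: power_Suc) simp
    also have "\<dots> \<le> 2 * C1 * X + C2 / \<delta> * (2 * \<rho> ^ j)"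
      using C \<delta>0 by (intro add_left_mono mult_left_mono pw) auto
    also have "C2 / \<delta> * (2 * \<rho> ^ j) = 2 * C2 / \<delta> * \<rho> ^ j" by simp
    finally show "real (card {q \<in> ?S. dist_nint (\<alpha> \<bullet> q) \<le> \<delta> * 2 ^ Suc j}) / (\<delta> * 2 ^ j)
        \<le> 2 * C1 * X + 2 * C2 / \<delta> * \<rho> ^ j" .
  qed
  also have "\<dots> = 2 * C1 * X * real J + 2 * C2 / \<delta> * (\<Sum>j<J. \<rho> ^ j)"
    by (simp add: sum.distrib sum_distrib_left)
  \<comment> \<open>The number of scales is about \<open>log 2 (1 / \<delta>)\<close>. Changing the
    base costs a factor 2, \<open>ln (1 / \<phi> Q)\<close> is at most \<open>1 / \<phi> Q\<close>,
    and the rounding term 1 is too; together they give the 3.\<close>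
  also have "\<dots> \<le> 2 * C1 * X * (2 * real CARD('n) * ln Q + 3 / \<phi> Q) + 2 * C2 / \<delta> * (1 / (1 - \<rho>))"
  proof (intro add_mono mult_left_mono)
    have "1 / \<delta> = X / \<phi> Q" by (simp add: \<delta>_def)
    then have "ln (1 / \<delta>) = real CARD('n) * ln Q + ln (1 / \<phi> Q)"
      using \<phi> Q by (simp add: X_def ln_div ln_realpow)
    moreover have "ln (1 / \<phi> Q) \<le> 1 / \<phi> Q"
      using \<phi> ln_le_minus_one[of "1 / \<phi> Q"] by simp
    ultimately have l: "ln (1 / \<delta>) \<le> real CARD('n) * ln Q + 1 / \<phi> Q" by simp
    have l0: "0 \<le> ln (1 / \<delta>)" using \<delta>0 \<delta>1 by (simp add: ln_ge_zero)
    have "log 2 (1 / \<delta>) \<le> 2 * ln (1 / \<delta>)"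
    proof -
      have "1 * ln (1 / \<delta>) \<le> (2 * ln 2) * ln (1 / \<delta>)"
        using l0 ln2_ge_two_thirds by (intro mult_right_mono) auto
      then show ?thesis by (simp add: log_def field_simps)
    qed
    moreover have "1 \<le> 1 / \<phi> Q" using \<phi> by simp
    moreover have "3 / \<phi> Q = 3 * (1 / \<phi> Q)" by simp
    ultimately show "real J \<le> 2 * real CARD('n) * ln Q + 3 / \<phi> Q" using J1 l by linarith
    have "(\<Sum>j<J. \<rho> ^ j) = (1 - \<rho> ^ J) / (1 - \<rho>)" using \<rho>01 by (simp add: sum_gp_strict)
    also have "\<dots> \<le> 1 / (1 - \<rho>)" using \<rho>01 by (intro divide_right_mono) auto
    finally show "(\<Sum>j<J. \<rho> ^ j) \<le> 1 / (1 - \<rho>)" .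
  qed (use C X1 \<delta>0 in auto)
  also have "\<dots> = 4 * real CARD('n) * C1 * (X * ln Q) + (6 * C1 + 2 * C2 / (1 - \<rho>)) * (X / \<phi> Q)"
    by (simp add: \<delta>_def algebra_simps)
  also have "\<dots> \<le> (4 * real CARD('n) * C1 + 6 * C1 + 2 * C2 / (1 - \<rho>)) * (X * ln Q + X / \<phi> Q)"
  proof -
    have le: "a * L + b * P \<le> (a + b) * (L + P)" if "0 \<le> a" "0 \<le> b" "0 \<le> L" "0 \<le> P" for a b L P :: real
      using mult_nonneg_nonneg[of a P] mult_nonneg_nonneg[of b L] that by (simp add: algebra_simps)
    have "0 \<le> X * ln Q" "0 \<le> X / \<phi> Q" using X1 Q \<phi> by auto
    moreover have "0 \<le> 4 * real CARD('n) * C1" "0 \<le> 6 * C1 + 2 * C2 / (1 - \<rho>)"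
      using C \<rho>01 by (auto intro!: add_nonneg_nonneg divide_nonneg_nonneg)
    ultimately show ?thesis
      using le[of "4 * real CARD('n) * C1" "6 * C1 + 2 * C2 / (1 - \<rho>)" "X * ln Q" "X / \<phi> Q"]
      by (simp only: add.assoc)
  qed
  finally show ?thesis by (simp add: X_def)
qed

section \<open>Both bounds together, with constants depending only on the dimension\<close>

theorem theorem1:
  "\<exists>c C :: real. c > 0 \<and> C > 0 \<and>
     (\<forall>(\<phi> :: real \<Rightarrow> real) (\<alpha> :: real ^ 'n) (Q :: real).
        \<phi> \<in> {0<..} \<rightarrow> {0<..1} \<longrightarrow> antimono_on {0<..} \<phi> \<longrightarrow>
        badly_approximable \<phi> \<alpha> \<longrightarrow> Q \<ge> 1 \<longrightarrow>
          Q ^ CARD('n) * ln (Q * \<phi> Q)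
            \<le> c * (\<Sum>q \<in> centered_cube Q \<inter> int_lattice - {0}. inverse (dist_nint (\<alpha> \<bullet> q))) \<and>
          (\<Sum>q \<in> centered_cube Q \<inter> int_lattice - {0}. inverse (dist_nint (\<alpha> \<bullet> q)))
            \<le> C * (Q ^ CARD('n) * ln Q + Q ^ CARD('n) / \<phi> Q))"
proof -
  define C1 :: real where "C1 = 4 ^ (CARD('n) + 1) * fact (CARD('n) + 1)"
  define C2 where "C2 = (2 * real CARD('n) + 4) ^ CARD('n)"
  define \<rho> :: real where "\<rho> = 2 powr (- (1 / (real CARD('n) + 1)))"
  define C where "C = 4 * real CARD('n) * C1 + 6 * C1 + 2 * C2 / (1 - \<rho>)"
  have "\<rho> < 1" unfolding \<rho>_def by (intro powr_less_one) auto
  moreover have "C1 > 0" "C2 > 0" by (simp_all add: C1_def C2_def add_pos_pos)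
  ultimately have "C > 0" unfolding C_def by (intro add_pos_pos) auto
  show ?thesis
  proof (rule exI[of _ 64], rule exI[of _ C], intro conjI allI impI)
    fix \<phi> :: "real \<Rightarrow> real" and \<alpha> :: "real^'n" and Q :: real
    assume \<phi>: "\<phi> \<in> {0<..} \<rightarrow> {0<..1}" and anti: "antimono_on {0<..} \<phi>"
      and ba: "badly_approximable \<phi> \<alpha>" and Q: "Q \<ge> 1"
    have \<phi>Q: "0 < \<phi> Q" "\<phi> Q \<le> 1" using \<phi> Q by (auto simp: Pi_iff)
    \<comment> \<open>Since \<open>inverse 0 = 0\<close>, a vanishing distance would contribute
      nothing to the sum; the lower bound relies on its absence.\<close>
    have "dist_nint (\<alpha> \<bullet> q) > 0" if "q \<in> int_lattice - {0}" for q
    proof -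
      have "0 < \<phi> (infnorm q)" using \<phi> that infnorm_pos_lt[of q] by (auto simp: Pi_iff)
      also have "\<dots> \<le> infnorm q ^ CARD('n) * dist_nint (\<alpha> \<bullet> q)"
        using ba that by (auto simp: badly_approximable_def)
      finally show ?thesis
        using infnorm_pos_le[of q] by (auto simp: zero_less_mult_iff dest: zero_less_power)
    qed
    then have "Q ^ CARD('n) * ln Q
        \<le> 64 * (\<Sum>q \<in> centered_cube Q \<inter> int_lattice - {0}. inverse (dist_nint (\<alpha> \<bullet> q)))"
      using Q by (intro sum_inverse_dist_ge) auto
    moreover have "Q ^ CARD('n) * ln (Q * \<phi> Q) \<le> Q ^ CARD('n) * ln Q"
      using Q \<phi>Q by (intro mult_left_mono) (auto simp: mult_left_le)
    ultimately show "Q ^ CARD('n) * ln (Q * \<phi> Q)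
        \<le> 64 * (\<Sum>q \<in> centered_cube Q \<inter> int_lattice - {0}. inverse (dist_nint (\<alpha> \<bullet> q)))"
      by linarith
    show "(\<Sum>q \<in> centered_cube Q \<inter> int_lattice - {0}. inverse (dist_nint (\<alpha> \<bullet> q)))
        \<le> C * (Q ^ CARD('n) * ln Q + Q ^ CARD('n) / \<phi> Q)"
      unfolding C_def using \<phi>Q anti ba Q C1_def C2_def \<rho>_def by (rule sum_inverse_dist_le)
  qed (use \<open>C > 0\<close> in auto)
qed

end
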